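(* Let $p_E=1$, $\lambda_H,\lambda_E>0$, and let $d\ge1$ be an integer constant independent of $p_H$. Then under the ChainMatch(d) policy $\mathcal{C}(d)$ in steady-state, $$\lim_{p_H\to0}p_H\,w_H^{\mathcal{C}(d)}=\frac{\ln\left(\frac{\lambda_H}{\lambda_E}+1\right)}{\lambda_H}.$$ Consequently, $\lim_{p_H\to0}p_H\,w_H^{\mathcal{C}(d)}$ decreases with $\lambda_E$ (for fixed $\lambda_H$) and with $\lambda_H$ (for fixed $\lambda_E$).
   Context: Model: agents of two types $H$ (hard-to-match) and $E$ (easy-to-match) arrive to a market according to independent Poisson processes with rates $\lambda_H,\lambda_E>0$. Each agent owns an item; an agent of type $T\in\{H,E\}$ finds the item of any other agent compatible with probability $p_T$, independently over all ordered pairs; there is a directed edge from $i$ to $j$ if $j$ finds $i$'s item compatible. Here $p_H\in(0,1)$ is a parameter tending to $0$. A waiting agent leaves only when matched, i.e. when she receives a compatible item. Policy ChainMatch(d) ($\mathcal{C}(d)$): the market starts with $d$ altruistic agents, who give an item without requiring one; at all times there are exactly $d$ bridge agents (an altruistic agent who has not yet given, or an agent who has received an item but not yet given hers). When a new agent $i_1$ arrives: if no bridge agent has an edge to $i_1$, then $i_1$ joins the market and waits. Otherwise one of the bridge agents with an edge to $i_1$ is chosen uniformly at random and gives her item to $i_1$ (ceasing to be a bridge agent), starting a chain-segment. The chain-segment advances instantaneously by local search: if the current last agent has an edge to at least one waiting agent not already in the chain-segment, one of these is selected at random, with $H$ agents favored over $E$ agents, is matched by the last agent and becomes the new last agent;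 this is repeated until the last agent has no edge to a remaining waiting agent. All agents of the chain-segment leave the market, and the last one becomes a bridge agent. The numbers $[H_t,E_t]$ of waiting (non-bridge) $H$ and $E$ agents form a positive recurrent continuous-time Markov chain: since each edge is examined at most once, edges may be revealed only when examined. $[H^{\mathcal{C}(d)},E^{\mathcal{C}(d)}]$ has its stationary distribution (started from an empty market), and by Little's law the steady-state average waiting time of $H$ agents is $w_H^{\mathcal{C}(d)}=\mathbb{E}[H^{\mathcal{C}(d)}]/\lambda_H$. *)

theory Defs
  imports "HOL-Probability.Probability"
begin

datatype agent = Hard | Easy

text \<open>
  A state \<open>(h, e)\<close> counts the waiting (non-bridge) hard- and easy-to-match agents.
  Compatibilities are independent and each ordered pair is examined at most once, so edges are
  drawn when they are examined. Agents of one type are exchangeable: the number of agents of a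
  type with an edge from a given agent is binomial, and neither which of them is selected nor
  which eligible bridge agent starts a chain-segment affects the law of the state.
\<close>

type_synonym state = "nat \<times> nat"

text \<open>
  \<open>advance pH pE h e\<close>: the agents left waiting once the chain-segment, whose last agent faces
  \<open>h\<close> hard and \<open>e\<close> easy waiting agents, has run to its end. The guards \<open>0 < h\<close> and \<open>0 < e\<close>
  are implied by the other conjunct for probabilities \<open>pH\<close>, \<open>pE\<close>; they serve termination.
\<close>

fun advance :: "real \<Rightarrow> real \<Rightarrow> nat \<Rightarrow> nat \<Rightarrow> state pmf" where
  "advance pH pE h e =
     do { i \<leftarrow> binomial_pmf h pH;
          j \<leftarrow> binomial_pmf e pE;
          if 0 < h \<and> 0 < i then advance pH pE (h - 1) e
          else if 0 < e \<and> 0 < j then advance pH pE h (e - 1)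
          else return_pmf (h, e) }"

declare advance.simps [simp del]

text \<open>
  An arriving agent who gets an item from a bridge agent is the first last agent of the
  chain-segment. The end of the segment becomes a bridge agent, so there are again \<open>d\<close> of them.
\<close>

fun arrival :: "real \<Rightarrow> real \<Rightarrow> nat \<Rightarrow> agent \<Rightarrow> state \<Rightarrow> state pmf" where
  "arrival pH pE d Hard (h, e) =
     do { k \<leftarrow> binomial_pmf d pH;
          if k = 0 then return_pmf (h + 1, e) else advance pH pE h e }"
| "arrival pH pE d Easy (h, e) =
     do { k \<leftarrow> binomial_pmf d pE;
          if k = 0 then return_pmf (h, e + 1) else advance pH pE h e }"

definition arrival_step :: "real \<Rightarrow> real \<Rightarrow> real \<Rightarrow> real \<Rightarrow> nat \<Rightarrow> state \<Rightarrow> state pmf" where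
  "arrival_step lH lE pH pE d s =
     do { hard \<leftarrow> bernoulli_pmf (lH / (lH + lE));
          arrival pH pE d (if hard then Hard else Easy) s }"

text \<open>
  Transition kernel of the continuous-time Markov chain over a time span \<open>t > 0\<close>, that is, the
  chain with rate \<open>lH * pmf (arrival pH pE d Hard s) s' + lE * pmf (arrival pH pE d Easy s) s'\<close>
  from \<open>s\<close> to \<open>s' \<noteq> s\<close>. The superposition of the two independent Poisson arrival processes is a
  Poisson process with rate \<open>lH + lE\<close> whose points are independently hard-to-match agents with
  probability \<open>lH / (lH + lE)\<close>, and the state changes only at arrivals.
\<close>

definition market_law ::
  "real \<Rightarrow> real \<Rightarrow> real \<Rightarrow> real \<Rightarrow> nat \<Rightarrow> real \<Rightarrow> state \<Rightarrow> state pmf" where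
  "market_law lH lE pH pE d t s =
     do { n \<leftarrow> poisson_pmf ((lH + lE) * t);
          ((\<lambda>D. bind_pmf D (arrival_step lH lE pH pE d)) ^^ n) (return_pmf s) }"

definition stationary :: "real \<Rightarrow> real \<Rightarrow> real \<Rightarrow> real \<Rightarrow> nat \<Rightarrow> state pmf \<Rightarrow> bool" where
  "stationary lH lE pH pE d D \<longleftrightarrow>
     (\<forall>t>0. bind_pmf D (market_law lH lE pH pE d t) = D)"

definition steady_state :: "real \<Rightarrow> real \<Rightarrow> real \<Rightarrow> real \<Rightarrow> nat \<Rightarrow> state pmf" where
  "steady_state lH lE pH pE d = (THE D. stationary lH lE pH pE d D)"

text \<open>Average waiting time of hard-to-match agents, defined through Little's law.\<close>

definition wH :: "real \<Rightarrow> real \<Rightarrow> real \<Rightarrow> real \<Rightarrow> nat \<Rightarrow> real" where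
  "wH lH lE pH pE d =
     measure_pmf.expectation (steady_state lH lE pH pE d) (\<lambda>(h, e). real h) / lH"

end

theory Submission
  imports Defs
begin

text \<open>
  With \<open>pE = 1\<close> a chain-segment clears all easy-to-match agents, so the stationary law lives on
  states \<open>(h, 0)\<close>. With \<open>q = 1 - pH\<close>, an arrival raises \<open>h\<close> with probability
  \<open>a = lH / (lH + lE) * q ^ d\<close> and otherwise starts a segment, whose last agent leaves behind \<open>k\<close>
  hard-to-match agents with probability \<open>q ^ k * (1 - q ^ (k + 1)) * \<dots> * (1 - q ^ h)\<close>. The weights
  \<open>w k = a ^ k / ((1 - q) * \<dots> * (1 - q ^ k))\<close> cancel these products, so the balance equation
  reduces to a geometric series. The generating function satisfies \<open>F (q z) = (1 - a z) * F z\<close>;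
  taking logarithmic derivatives, the mean is the sum of \<open>a q ^ n / (1 - a q ^ n)\<close> over all \<open>n\<close>, and
  \<open>1 - q\<close> times this sum tends to the integral of \<open>a / (1 - a x)\<close> over \<open>[0, 1]\<close>.
\<close>

subsection \<open>Uniqueness of stationary distributions\<close>

lemma integrable_pmf_iff_count_space:
  fixes f :: "'a \<Rightarrow> real"
  shows "integrable (measure_pmf p) f \<longleftrightarrow> integrable (count_space UNIV) (\<lambda>x. pmf p x * f x)"
  unfolding measure_pmf_eq_density by (subst integrable_real_density) auto

lemma expectation_eq_count_space:
  fixes f :: "'a \<Rightarrow> real"
  shows "measure_pmf.expectation p f = (LINT x|count_space UNIV. pmf p x * f x)"
  unfolding measure_pmf_eq_density by (subst integral_real_density) auto

lemma integrable_indicator_pmf: "integrable (measure_pmf p) (indicator A :: 'a \<Rightarrow> real)"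
  by (rule measure_pmf.integrable_const_bound[of _ 1]) auto

text \<open>
  The set \<open>A\<close> where \<open>D\<close> exceeds \<open>E\<close> cannot lose any of its excess mass in one step, so the chain
  never leaves \<open>A\<close>; hence \<open>A\<close> contains every state reachable from all others.
\<close>

lemma stationary_larger_at_common_successor:
  fixes M :: "'a \<Rightarrow> 'a pmf"
  assumes D: "bind_pmf D M = D" and E: "bind_pmf E M = E"
    and z: "\<And>x. z \<in> set_pmf (M x)"
    and gt: "pmf D x > pmf E x"
  shows "pmf D z > pmf E z"
proof -
  define A where "A = {s. pmf D s > pmf E s}"
  define g where "g = (\<lambda>s. measure_pmf.prob (M s) A)"
  \<comment> \<open>Both factors of \<open>u s\<close> are nonnegative on \<open>A\<close> and
    nonpositive off it, so \<open>u\<close> is nonnegative; stationarity of \<open>D\<close> and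
    \<open>E\<close> makes its total zero.\<close>
  define u where "u = (\<lambda>s. (pmf D s - pmf E s) * (indicator A s - g s))"
  have g01: "0 \<le> g s" "g s \<le> 1" for s
    by (simp_all add: g_def)
  have int_g: "integrable (measure_pmf P) g" for P
    by (rule measure_pmf.integrable_const_bound[of _ 1]) (auto simp: g_def)
  then have int: "integrable (measure_pmf P) (\<lambda>s. indicator A s - g s :: real)" for P
    by (intro Bochner_Integration.integrable_diff integrable_indicator_pmf)
  have zero: "measure_pmf.expectation P (\<lambda>s. indicator A s - g s) = 0"
    if "bind_pmf P M = P" for P
  proof -
    have "measure_pmf.prob P A = measure_pmf.prob (bind_pmf P M) A"
      by (simp add: that)
    also have "\<dots> = measure_pmf.expectation P g"
      unfolding g_def measure_pmf_bind
      by (rule measure_pmf.measure_bind[where N = "count_space UNIV"]) (auto simp: measure_subprob)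
    finally show ?thesis
      using int_g by (subst Bochner_Integration.integral_diff) (simp_all add: integrable_indicator_pmf)
  qed
  have u_nonneg: "0 \<le> u s" for s
    using g01[of s] by (auto simp: u_def A_def mult_le_0_iff split: split_indicator)
  have u_eq: "u = (\<lambda>s. pmf D s * (indicator A s - g s) - pmf E s * (indicator A s - g s))"
    by (simp add: u_def fun_eq_iff algebra_simps)
  have u_int: "integrable (count_space UNIV) u"
    unfolding u_eq using int[of D] int[of E]
    by (intro Bochner_Integration.integrable_diff) (simp_all add: integrable_pmf_iff_count_space)
  have "(LINT s|count_space UNIV. u s) = 0"
    unfolding u_eq using int[of D] int[of E] zero[OF D] zero[OF E]
    by (subst Bochner_Integration.integral_diff)
      (simp_all add: integrable_pmf_iff_count_space expectation_eq_count_space)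
  then have "AE s in count_space UNIV. u s = 0"
    using integral_nonneg_eq_0_iff_AE[OF u_int] u_nonneg by simp
  then have "u x = 0"
    by (simp add: AE_count_space)
  then have "measure_pmf.prob (M x) A = 1"
    using gt by (simp add: u_def A_def g_def)
  then have "set_pmf (M x) \<subseteq> A"
    using measure_pmf.AE_in_set_eq_1[of A "M x"] by (auto simp: AE_measure_pmf_iff)
  then show ?thesis
    using z[of x] by (auto simp: A_def)
qed

text \<open>If \<open>D\<close> exceeds \<open>E\<close> somewhere, it does so at \<open>z\<close>,
  and vice versa; both cannot happen at the same \<open>z\<close>. So one law dominates the other
  pointwise, and equal total mass forces equality.\<close>

lemma stationary_unique:
  fixes M :: "'a \<Rightarrow> 'a pmf"
  assumes D: "bind_pmf D M = D" and E: "bind_pmf E M = E"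
    and z: "\<And>x. z \<in> set_pmf (M x)"
  shows "D = E"
proof -
  have le_eq: "P = Q" if le: "\<And>x. pmf P x \<le> pmf Q x" for P Q :: "'a pmf"
  proof (rule pmf_eqI)
    fix x
    have int: "integrable (count_space UNIV) (\<lambda>x. pmf Q x - pmf P x)"
      by (intro Bochner_Integration.integrable_diff integrable_pmf)
    have "(LINT x|count_space UNIV. pmf Q x - pmf P x) = 0"
      by (subst Bochner_Integration.integral_diff) (simp_all add: integrable_pmf integral_pmf)
    then have "AE x in count_space UNIV. pmf Q x - pmf P x = 0"
      using integral_nonneg_eq_0_iff_AE[OF int] le by simp
    then show "pmf P x = pmf Q x"
      by (simp add: AE_count_space)
  qed
  show ?thesis
  proof (cases "\<exists>x. pmf D x > pmf E x")
    case True
    then have "\<not> pmf E x > pmf D x" for x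
      using stationary_larger_at_common_successor[OF D E z]
        stationary_larger_at_common_successor[OF E D z] by (meson less_asym)
    then show ?thesis
      using le_eq[of E D] by (simp add: not_less)
  next
    case False
    then show ?thesis
      using le_eq[of D E] by (simp add: not_less)
  qed
qed

subsection \<open>Chain-segments when every easy-to-match agent is compatible\<close>

lemma pmf_bind_binomial_zero:
  assumes "0 \<le> p" "p \<le> 1"
  shows "pmf (bind_pmf (binomial_pmf n p) (\<lambda>k. if k = 0 then A else B)) s
      = (1 - p) ^ n * pmf A s + (1 - (1 - p) ^ n) * pmf B s"
proof -
  have "pmf (bind_pmf (binomial_pmf n p) (\<lambda>k. if k = 0 then A else B)) s
      = measure_pmf.expectation (binomial_pmf n p)
          (\<lambda>k. pmf B s + (pmf A s - pmf B s) * indicator {0} k)"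
    unfolding pmf_bind by (intro Bochner_Integration.integral_cong) auto
  also have "\<dots> = pmf B s + (pmf A s - pmf B s) * pmf (binomial_pmf n p) 0"
    by (subst Bochner_Integration.integral_add) (simp_all add: measure_pmf_single integrable_indicator_pmf)
  also have "pmf (binomial_pmf n p) 0 = (1 - p) ^ n"
    using assms by simp
  finally show ?thesis
    by (simp add: algebra_simps)
qed

lemma advance_no_easy:
  assumes "0 < p" "p < 1"
  shows "advance p 1 h 0
      = bind_pmf (binomial_pmf h p) (\<lambda>i. if i = 0 then return_pmf (h, 0) else advance p 1 (h - 1) 0)"
  using assms
  by (subst advance.simps) (auto simp: binomial_pmf_0 bind_return_pmf intro!: bind_pmf_cong)

text \<open>At \<open>h = 0\<close> the truncated \<open>h - 1\<close> is harmless: its coefficient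
  \<open>1 - (1 - p) ^ 0\<close> vanishes.\<close>

lemma pmf_advance_no_easy:
  assumes "0 < p" "p < 1"
  shows "pmf (advance p 1 h 0) s
      = (1 - p) ^ h * of_bool (s = (h, 0)) + (1 - (1 - p) ^ h) * pmf (advance p 1 (h - 1) 0) s"
  using assms by (subst advance_no_easy) (auto simp: pmf_bind_binomial_zero)

lemma set_pmf_advance_no_easy:
  assumes "0 < p" "p < 1"
  shows "set_pmf (advance p 1 h 0) \<subseteq> {..h} \<times> {0}"
proof (induction h)
  case 0
  then show ?case
    using assms by (subst advance_no_easy) (auto simp: binomial_pmf_0 bind_return_pmf)
next
  case (Suc h)
  then show ?case
    using assms by (subst advance_no_easy) (auto split: if_splits)
qed

text \<open>A hard-to-match agent can be picked because \<open>p > 0\<close>; once none is left,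
  \<open>pE = 1\<close> forces the segment through all easy-to-match agents. This supplies the
  common successor for uniqueness.\<close>

lemma zero_in_set_pmf_advance:
  assumes "0 < p" "p < 1"
  shows "(0, 0) \<in> set_pmf (advance p 1 h e)"
proof (induction "h + e" arbitrary: h e)
  case 0
  then show ?case
    using assms by (subst advance.simps) (simp add: binomial_pmf_0 bind_return_pmf)
next
  case (Suc n)
  show ?case
  proof (cases h)
    case 0
    with Suc have "(0, 0) \<in> set_pmf (advance p 1 0 (e - 1))" "0 < e"
      by auto
    then show ?thesis
      using assms 0 by (subst advance.simps) (simp add: binomial_pmf_0 bind_return_pmf)
  next
    case h: (Suc m)
    with Suc have "(0, 0) \<in> set_pmf (advance p 1 m e)"
      by auto
    then show ?thesis
      using assms h by (subst advance.simps) (auto intro!: bexI[of _ 1])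
  qed
qed

subsection \<open>The q-series distribution\<close>

locale q_series =
  fixes a q :: real
  assumes a_pos: "0 < a" and a_less_1: "a < 1" and q_pos: "0 < q" and q_less_1: "q < 1"
begin

text \<open>The denominator is the q-Pochhammer symbol \<open>(q; q)_k\<close>; these are the
  coefficients in Euler's expansion of the reciprocal of the infinite product of
  \<open>1 - a * q ^ n * z\<close>.\<close>

definition w :: "nat \<Rightarrow> real" where
  "w k = a ^ k / (\<Prod>i=1..k. 1 - q ^ i)"

lemma w_0 [simp]: "w 0 = 1"
  by (simp add: w_def)

lemma q_power_Suc_less_1: "q ^ Suc k < 1"
  using q_pos q_less_1 by (intro power_Suc_less_one) auto

lemma w_Suc: "w (Suc k) * (1 - q ^ Suc k) = a * w k"
  using q_power_Suc_less_1[of k] by (simp add: w_def prod.nat_ivl_Suc')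

lemma w_pos: "w k > 0"
proof -
  have "(\<Prod>i=1..k. 1 - q ^ i) > 0"
    using q_power_Suc_less_1 by (intro prod_pos) (metis One_nat_def Suc_le_D atLeastAtMost_iff diff_gt_0_iff_gt)
  then show ?thesis
    using a_pos by (simp add: w_def)
qed

text \<open>The ratio of successive terms tends to \<open>a < 1\<close>, so it eventually stays
  below the midpoint \<open>c\<close> of \<open>a\<close> and 1. The factor \<open>Suc k\<close>
  lets this one series dominate those of both \<open>F\<close> and \<open>G\<close> on
  [0, 1].\<close>

lemma summable_Suc_w: "summable (\<lambda>k. real (Suc k) * w k)"
proof -
  define c where "c = (a + 1) / 2"
  have c: "a < c" "c < 1"
    using a_less_1 by (simp_all add: c_def)
  have "(\<lambda>k. (1 + 1 / real (Suc k)) * (a / (1 - q ^ Suc k))) \<longlonglongrightarrow> (1 + 0) * (a / (1 - 0))"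
    using q_pos q_less_1
    by (intro tendsto_intros LIMSEQ_Suc[OF LIMSEQ_power_zero] LIMSEQ_Suc[OF lim_1_over_n]) auto
  then have "\<forall>\<^sub>F k in sequentially. (1 + 1 / real (Suc k)) * (a / (1 - q ^ Suc k)) < c"
    using c by (intro order_tendstoD(2)[where y = "(1 + 0) * (a / (1 - 0))"]) auto
  then obtain N where N: "\<And>k. k \<ge> N \<Longrightarrow> (1 + 1 / real (Suc k)) * (a / (1 - q ^ Suc k)) < c"
    by (auto simp: eventually_sequentially)
  show ?thesis
  proof (rule summable_ratio_test[OF c(2)])
    fix k assume "N \<le> k"
    have "w (Suc k) = a / (1 - q ^ Suc k) * w k"
      using w_Suc[of k] q_power_Suc_less_1[of k] by (simp add: field_simps)
    moreover have "real (Suc (Suc k)) = (1 + 1 / real (Suc k)) * real (Suc k)"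
      by (simp add: field_simps)
    ultimately have "real (Suc (Suc k)) * w (Suc k)
        = (1 + 1 / real (Suc k)) * (a / (1 - q ^ Suc k)) * (real (Suc k) * w k)"
      by (simp only: ac_simps)
    also have "\<dots> \<le> c * (real (Suc k) * w k)"
      using N[OF \<open>N \<le> k\<close>] w_pos[of k] by (intro mult_right_mono) auto
    finally show "norm (real (Suc (Suc k)) * w (Suc k)) \<le> c * norm (real (Suc k) * w k)"
      using w_pos[of k] w_pos[of "Suc k"] by (simp add: abs_mult)
  qed
qed

section \<open>Generating functions and their q-difference equations\<close>

lemma summable_w_power:
  assumes "0 \<le> z" "z \<le> 1"
  shows "summable (\<lambda>k. w k * z ^ k)" and "summable (\<lambda>k. real k * w k * z ^ k)"
proof -
  have "w k * z ^ k \<le> real (Suc k) * w k" "real k * w k * z ^ k \<le> real (Suc k) * w k" for k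
    using assms w_pos[of k] power_le_one[OF assms, of k]
      mult_mono[of "w k" "real (Suc k) * w k" "z ^ k" 1]
      mult_mono[of "real k * w k" "real (Suc k) * w k" "z ^ k" 1]
    by (auto simp: mult_right_mono)
  then show "summable (\<lambda>k. w k * z ^ k)" "summable (\<lambda>k. real k * w k * z ^ k)"
    using assms w_pos summable_Suc_w
    by (auto intro!: summable_comparison_test'[OF summable_Suc_w, of 0] simp: abs_mult less_imp_le)
qed

definition F :: "real \<Rightarrow> real" where "F z = (\<Sum>k. w k * z ^ k)"

text \<open>This is \<open>z * F' z\<close>, given by its series so that its functional equation
  follows coefficientwise.\<close>

definition G :: "real \<Rightarrow> real" where "G z = (\<Sum>k. real k * w k * z ^ k)"

lemma F_ge_1:
  assumes "0 \<le> z" "z \<le> 1"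
  shows "F z \<ge> 1"
  using sum_le_suminf[OF summable_w_power(1)[OF assms], of "{0}"] w_pos assms
  by (simp add: F_def less_imp_le)

text \<open>The coefficients of \<open>F z - F (q * z)\<close> are \<open>w k * (1 - q ^ k)\<close>;
  the constant one vanishes, and \<open>w_Suc\<close> turns the others into those of
  \<open>a * z * F z\<close>.\<close>

lemma F_functional_eq:
  assumes z: "0 \<le> z" "z \<le> 1"
  shows "F (q * z) = (1 - a * z) * F z"
proof -
  have qz: "0 \<le> q * z" "q * z \<le> 1"
    using z q_pos q_less_1 by (auto simp: mult_le_one)
  note s = summable_w_power(1)[OF z] and s' = summable_w_power(1)[OF qz]
  have "F z - F (q * z) = (\<Sum>k. w k * (1 - q ^ k) * z ^ k)"
    unfolding F_def using s s' by (subst suminf_diff) (auto simp: algebra_simps power_mult_distrib)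
  also have "\<dots> = (\<Sum>k. w (Suc k) * (1 - q ^ Suc k) * z ^ Suc k)"
  proof -
    have "summable (\<lambda>k. w k * (1 - q ^ k) * z ^ k)"
      using summable_diff[OF s s'] by (simp add: algebra_simps power_mult_distrib)
    from suminf_split_head[OF this] show ?thesis by simp
  qed
  also have "\<dots> = (\<Sum>k. a * z * (w k * z ^ k))"
    by (simp only: w_Suc) (simp add: ac_simps)
  also have "\<dots> = a * z * F z"
    unfolding F_def by (rule suminf_mult[OF s])
  finally show ?thesis
    by (simp add: algebra_simps)
qed

text \<open>Formally \<open>z * d/dz\<close> applied to \<open>F_functional_eq\<close>. After the
  index shift the factor \<open>Suc k\<close> splits into \<open>k\<close> and 1, which produces
  \<open>G\<close> and \<open>F\<close>.\<close>

lemma G_functional_eq: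
  assumes z: "0 \<le> z" "z \<le> 1"
  shows "G z * (1 - a * z) = G (q * z) + a * z * F z"
proof -
  have qz: "0 \<le> q * z" "q * z \<le> 1"
    using z q_pos q_less_1 by (auto simp: mult_le_one)
  note s = summable_w_power(2)[OF z] and s' = summable_w_power(2)[OF qz]
  have "G z - G (q * z) = (\<Sum>k. real k * (w k * (1 - q ^ k)) * z ^ k)"
    unfolding G_def using s s' by (subst suminf_diff) (auto simp: algebra_simps power_mult_distrib)
  also have "\<dots> = (\<Sum>k. real (Suc k) * (w (Suc k) * (1 - q ^ Suc k)) * z ^ Suc k)"
  proof -
    have "summable (\<lambda>k. real k * (w k * (1 - q ^ k)) * z ^ k)"
      using summable_diff[OF s s'] by (simp add: algebra_simps power_mult_distrib)
    from suminf_split_head[OF this] show ?thesis by simp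
  qed
  also have "\<dots> = (\<Sum>k. a * z * (real k * w k * z ^ k + w k * z ^ k))"
    by (simp only: w_Suc) (simp add: algebra_simps)
  also have "\<dots> = a * z * (G z + F z)"
    unfolding F_def G_def using s summable_w_power(1)[OF z]
    by (subst suminf_mult) (simp_all add: suminf_add summable_add)
  finally show ?thesis
    by (simp add: algebra_simps)
qed

text \<open>The logarithmic derivative of the generating function \<open>F\<close>, times the argument.\<close>

definition L :: "real \<Rightarrow> real" where "L z = G z / F z"

text \<open>Quotient of the two functional equations. Iterated from \<open>z = 1\<close> along the
  powers of \<open>q\<close>, it expands \<open>L 1\<close> into a sum with remainder
  \<open>L (q ^ n)\<close>.\<close>

lemma L_step:
  assumes z: "0 \<le> z" "z \<le> 1"
  shows "L z = L (q * z) + a * z / (1 - a * z)"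
proof -
  have "a * z \<le> a"
    using z a_pos by (simp add: mult_left_le)
  then have az: "1 - a * z > 0"
    using a_less_1 by simp
  have F: "F z > 0"
    using F_ge_1[OF z] by simp
  have "L (q * z) = (G z * (1 - a * z) - a * z * F z) / ((1 - a * z) * F z)"
    using G_functional_eq[OF z] F_functional_eq[OF z] by (simp add: L_def)
  also have "\<dots> = L z - a * z / (1 - a * z)"
    using az F by (simp add: L_def diff_divide_distrib)
  finally show ?thesis
    by simp
qed

text \<open>Every nonzero term of \<open>G z\<close> has \<open>k \<ge> 1\<close>, so
  \<open>z ^ k \<le> z\<close>, and \<open>F z \<ge> 1\<close>. This makes the remainder
  \<open>L (q ^ n)\<close> vanish in the limit.\<close>

lemma L_le: "0 \<le> z \<Longrightarrow> z \<le> 1 \<Longrightarrow> L z \<le> z * G 1"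
proof -
  assume z: "0 \<le> z" "z \<le> 1"
  have "real k * w k * z ^ k \<le> z * (real k * w k)" for k
  proof (cases k)
    case (Suc m)
    have "z ^ k \<le> z * 1"
      using z power_le_one[of z m] unfolding Suc power_Suc by (intro mult_left_mono) auto
    then have "real k * w k * z ^ k \<le> real k * w k * z"
      using w_pos[of k] by (intro mult_left_mono) auto
    then show ?thesis
      by (simp add: ac_simps)
  qed simp
  then have "G z \<le> (\<Sum>k. z * (real k * w k))"
    unfolding G_def using summable_w_power(2)[OF z] summable_w_power(2)[of 1]
    by (intro suminf_le) auto
  also have "\<dots> = z * G 1"
    unfolding G_def using summable_w_power(2)[of 1] by (subst suminf_mult) auto
  finally have "G z \<le> z * G 1" .
  moreover have "0 \<le> G z"
    unfolding G_def using z w_pos by (intro suminf_nonneg summable_w_power(2)) (auto simp: less_imp_le)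
  ultimately show "L z \<le> z * G 1"
    using F_ge_1[OF z] unfolding L_def
    by (smt (verit, best) div_by_1 frac_le)
qed

lemma L_nonneg: "0 \<le> z \<Longrightarrow> z \<le> 1 \<Longrightarrow> 0 \<le> L z"
  unfolding L_def using F_ge_1[of z] w_pos
  by (intro divide_nonneg_nonneg) (auto simp: G_def less_imp_le intro!: suminf_nonneg summable_w_power(2))

lemma L_power_tendsto_0: "(\<lambda>n. L (q ^ n)) \<longlonglongrightarrow> 0"
proof (rule tendsto_sandwich[of "\<lambda>_. 0"])
  show "(\<lambda>n. q ^ n * G 1) \<longlonglongrightarrow> 0"
    using q_pos q_less_1 by (intro tendsto_mult_left_zero LIMSEQ_power_zero) auto
qed (use q_pos q_less_1 L_nonneg L_le in \<open>auto simp: power_le_one\<close>)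

text \<open>
  \<open>L 1\<close> is the Riemann-type sum of \<open>a z / (1 - a z)\<close> over the nodes \<open>z = q ^ n\<close>; comparing each
  term with an increment of \<open>ln (1 - a z)\<close> makes both bounds telescope.
\<close>

lemma L_1_lower: "- ln (1 - a) \<le> (1 - q) * L 1"
proof -
  \<comment> \<open>This sequence is nonincreasing with limit 0, so \<open>\<phi> 0 \<ge> 0\<close>,
    which is the claim.\<close>
  define \<phi> where "\<phi> n = (1 - q) * L (q ^ n) + ln (1 - a * q ^ n)" for n
  have "\<phi> (Suc n) \<le> \<phi> n" for n
  proof -
    define z where "z = q ^ n"
    have z: "0 < z" "z \<le> 1"
      using q_pos q_less_1 by (auto simp: z_def power_le_one)
    have az: "a * z < 1"
      using a_less_1 a_pos z by (smt (verit) mult_left_le)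
    have aqz: "a * (q * z) < 1"
      using az a_pos z q_less_1 q_pos
      by (smt (verit) mult_less_cancel_right_pos mult_pos_pos mult.assoc mult.left_commute mult_less_cancel_right1)
    have "ln (1 - a * (q * z)) - ln (1 - a * z) = ln ((1 - a * (q * z)) / (1 - a * z))"
      using az aqz by (simp add: ln_div)
    also have "\<dots> \<le> (1 - a * (q * z)) / (1 - a * z) - 1"
      using az aqz by (intro ln_le_minus_one) auto
    also have "\<dots> = (1 - q) * (a * z / (1 - a * z))"
      using az by (simp add: field_simps)
    also have "\<dots> = (1 - q) * (L z - L (q * z))"
      using L_step[of z] z by simp
    finally show ?thesis
      by (simp add: \<phi>_def z_def algebra_simps)
  qed
  then have "decseq \<phi>"
    by (rule decseq_SucI)
  moreover have "\<phi> \<longlonglongrightarrow> (1 - q) * 0 + ln (1 - a * 0)"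
    unfolding \<phi>_def using q_pos q_less_1
    by (intro tendsto_intros L_power_tendsto_0 LIMSEQ_power_zero) auto
  ultimately have "0 \<le> \<phi> 0"
    using decseq_ge[of \<phi> 0 0] by simp
  then show ?thesis
    by (simp add: \<phi>_def)
qed

lemma L_1_upper:
  assumes "a < q"
  shows "(1 - q) * L 1 \<le> - q * ln (1 - a / q)"
proof -
  \<comment> \<open>Replacing \<open>a\<close> by \<open>a / q\<close> shifts the logarithm by one
    node, since \<open>a / q * (q * z) = a * z\<close>; the factor \<open>q\<close> makes
    \<open>ln x \<le> x - 1\<close> yield exactly the increment of \<open>L\<close>. Now the
    sequence is nondecreasing with limit 0, and \<open>a < q\<close> keeps the arguments of
    \<open>ln\<close> positive.\<close>
  define \<phi> where "\<phi> n = (1 - q) * L (q ^ n) + q * ln (1 - a / q * q ^ n)" for n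
  have "\<phi> n \<le> \<phi> (Suc n)" for n
  proof -
    define z where "z = q ^ n"
    have z: "0 < z" "z \<le> 1"
      using q_pos q_less_1 by (auto simp: z_def power_le_one)
    have az: "a * z < q"
      using assms a_pos z by (smt (verit) mult_left_le)
    have az1: "a * z < 1"
      using az q_less_1 by simp
    have "ln (1 - a / q * z) - ln (1 - a * z) = ln ((1 - a / q * z) / (1 - a * z))"
      using az az1 q_pos by (subst ln_div) (auto simp: field_simps)
    also have "\<dots> \<le> (1 - a / q * z) / (1 - a * z) - 1"
      using az az1 q_pos by (intro ln_le_minus_one divide_pos_pos) (auto simp: field_simps)
    also have "\<dots> = - ((1 - q) / q * (a * z / (1 - a * z)))"
      using az1 q_pos by (simp add: divide_simps) (simp add: algebra_simps)
    also have "\<dots> = - ((1 - q) / q * (L z - L (q * z)))"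
      using L_step[of z] z by simp
    finally have "ln (1 - a / q * z) - ln (1 - a * z) \<le> - ((1 - q) / q * (L z - L (q * z)))" .
    then have "q * (ln (1 - a / q * z) - ln (1 - a * z))
        \<le> q * (- ((1 - q) / q * (L z - L (q * z))))"
      using q_pos by (intro mult_left_mono) auto
    also have "\<dots> = - ((1 - q) * (L z - L (q * z)))"
      using q_pos by simp
    finally have "(1 - q) * L z + q * ln (1 - a / q * z)
        \<le> (1 - q) * L (q * z) + q * ln (1 - a * z)"
      by (simp only: right_diff_distrib)
    moreover have "a / q * (q * z) = a * z"
      using q_pos by simp
    ultimately show ?thesis
      unfolding \<phi>_def z_def power_Suc by simp
  qed
  then have "incseq \<phi>"
    by (rule incseq_SucI)
  moreover have "\<phi> \<longlonglongrightarrow> (1 - q) * 0 + q * ln (1 - a / q * 0)"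
    unfolding \<phi>_def using q_pos q_less_1
    by (intro tendsto_intros L_power_tendsto_0 LIMSEQ_power_zero) auto
  ultimately have "\<phi> 0 \<le> 0"
    using incseq_le[of \<phi> 0 0] by simp
  then show ?thesis
    by (simp add: \<phi>_def)
qed

section \<open>The normalised weights: mean and invariance\<close>

definition dist_pmf :: "nat pmf" where
  "dist_pmf = embed_pmf (\<lambda>k. w k / F 1)"

lemma pmf_dist_pmf: "pmf dist_pmf k = w k / F 1"
  unfolding dist_pmf_def
proof (rule pmf_embed_pmf)
  have F: "F 1 > 0"
    using F_ge_1[of 1] by simp
  have s: "summable w" "suminf w = F 1"
    using summable_w_power(1)[of 1] by (simp_all add: F_def)
  show nn: "0 \<le> w k / F 1" for k
    using w_pos[of k] F by simp
  have "(\<integral>\<^sup>+ k. ennreal (w k / F 1) \<partial>count_space UNIV) = ennreal (\<Sum>k. w k / F 1)"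
    using nn s summable_divide by (subst nn_integral_count_space_nat) (intro suminf_ennreal2)
  also have "\<dots> = 1"
    using s F by (simp add: suminf_divide)
  finally show "(\<integral>\<^sup>+ k. ennreal (w k / F 1) \<partial>count_space UNIV) = 1" .
qed

lemma expectation_dist_pmf:
  assumes "summable (\<lambda>k. w k * \<bar>f k\<bar>)"
  shows "integrable (measure_pmf dist_pmf) f"
    and "measure_pmf.expectation dist_pmf f = (\<Sum>k. w k * f k) / F 1"
proof -
  have F: "F 1 > 0"
    using F_ge_1[of 1] by simp
  have "summable (\<lambda>k. w k * \<bar>f k\<bar> / F 1)"
    using assms by (rule summable_divide)
  then have int: "integrable (count_space UNIV) (\<lambda>k. w k / F 1 * f k)"
    using w_pos F by (simp add: integrable_count_space_nat_iff abs_mult less_imp_le)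
  then show "integrable (measure_pmf dist_pmf) f"
    by (simp add: integrable_pmf_iff_count_space pmf_dist_pmf)
  have "summable (\<lambda>k. w k * f k)"
    by (rule summable_rabs_cancel) (use assms w_pos in \<open>simp add: abs_mult less_imp_le\<close>)
  then show "measure_pmf.expectation dist_pmf f = (\<Sum>k. w k * f k) / F 1"
    using integral_count_space_nat[OF int]
    by (simp add: expectation_eq_count_space pmf_dist_pmf suminf_divide)
qed

lemma mean_dist_pmf:
  shows "integrable (measure_pmf dist_pmf) real"
    and "measure_pmf.expectation dist_pmf real = L 1"
proof -
  have "summable (\<lambda>k. w k * \<bar>real k\<bar>)"
    using summable_w_power(2)[of 1] by (simp add: ac_simps)
  from expectation_dist_pmf[OF this]
  show "integrable (measure_pmf dist_pmf) real" "measure_pmf.expectation dist_pmf real = L 1"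
    by (simp_all add: L_def G_def ac_simps)
qed

text \<open>Getting from \<open>k + m\<close> down to \<open>k\<close> costs a factor
  \<open>1 - q ^ h\<close> for each \<open>h\<close> from \<open>k + m\<close> to
  \<open>k + 1\<close>; each cancels against the weight and leaves a factor \<open>a\<close>. The
  factor \<open>q ^ k\<close> is the chance of stopping once \<open>k\<close> agents are
  left.\<close>

lemma pmf_advance_weighted:
  "w (k + m) * pmf (advance (1 - q) 1 (k + m) 0) (k, 0) = q ^ k * w k * a ^ m"
proof (induction m)
  case 0
  \<comment> \<open>After a removal fewer than \<open>k\<close> agents remain, so from
    \<open>k\<close> only stopping at once ends in \<open>k\<close>.\<close>
  have "(k, 0) \<notin> set_pmf (advance (1 - q) 1 (k - 1) 0)" if "0 < k"
    using set_pmf_advance_no_easy[of "1 - q" "k - 1"] q_pos q_less_1 that by auto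
  then show ?case
    using q_pos q_less_1
    by (cases "k = 0"; subst pmf_advance_no_easy) (auto simp: pmf_eq_0_set_pmf)
next
  case (Suc m)
  have "w (k + Suc m) * pmf (advance (1 - q) 1 (k + Suc m) 0) (k, 0)
      = w (Suc (k + m)) * (1 - q ^ Suc (k + m)) * pmf (advance (1 - q) 1 (k + m) 0) (k, 0)"
    using q_pos q_less_1 by (subst pmf_advance_no_easy) auto
  also have "\<dots> = a * (w (k + m) * pmf (advance (1 - q) 1 (k + m) 0) (k, 0))"
    by (simp only: w_Suc mult.assoc)
  also have "\<dots> = q ^ k * w k * a ^ Suc m"
    by (simp add: Suc.IH)
  finally show ?case .
qed

text \<open>Mass balance at \<open>k\<close>: arrivals that wait bring in
  \<open>w k * (1 - q ^ k)\<close>, and segments that stop at \<open>k\<close> bring in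
  \<open>q ^ k * w k\<close>, because the geometric series over the starting points
  \<open>k + m\<close> cancels the factor \<open>1 - a\<close>.\<close>

lemma dist_pmf_invariant:
  assumes K: "\<And>h s. pmf (K (h, 0)) s
      = a * of_bool (s = (Suc h, 0)) + (1 - a) * pmf (advance (1 - q) 1 h 0) s"
  shows "bind_pmf (map_pmf (\<lambda>h. (h, 0)) dist_pmf) K = map_pmf (\<lambda>h. (h, 0)) dist_pmf"
proof (rule pmf_eqI)
  fix s :: state
  obtain k e where s: "s = (k, e)"
    by (cases s)
  have adv0: "pmf (advance (1 - q) 1 h 0) (k, e) = 0" if "e \<noteq> 0 \<or> h < k" for h
    using set_pmf_advance_no_easy[of "1 - q" h] q_pos q_less_1 that by (auto simp: pmf_eq_0_set_pmf)
  have bind: "pmf (bind_pmf (map_pmf (\<lambda>h. (h, 0)) dist_pmf) K) s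
      = measure_pmf.expectation dist_pmf (\<lambda>h. pmf (K (h, 0)) s)"
    by (simp add: bind_map_pmf pmf_bind)
  show "pmf (bind_pmf (map_pmf (\<lambda>h. (h, 0)) dist_pmf) K) s
      = pmf (map_pmf (\<lambda>h. (h, 0)) dist_pmf) s"
  proof (cases "e = 0")
    case False
    then have "s \<notin> set_pmf (map_pmf (\<lambda>h. (h, 0)) dist_pmf)"
      by (auto simp: s)
    then show ?thesis
      using False unfolding bind by (simp add: K s adv0 pmf_eq_0_set_pmf)
  next
    case True
    have up: "(\<lambda>h. w h * (a * of_bool (k = Suc h))) sums (w k * (1 - q ^ k))"
    proof (cases k)
      case (Suc j)
      have "(\<lambda>h. if h = j then w h * a else 0) sums (w j * a)"
        by (rule sums_single)
      moreover have "w j * a = w k * (1 - q ^ k)"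
        using w_Suc[of j] by (simp add: Suc)
      moreover have "(\<lambda>h. if h = j then w h * a else 0) = (\<lambda>h. w h * (a * of_bool (k = Suc h)))"
        by (auto simp: Suc fun_eq_iff)
      ultimately show ?thesis
        by simp
    qed simp
    have "(\<lambda>m. w (m + k) * pmf (advance (1 - q) 1 (m + k) 0) s) sums (q ^ k * w k * (1 / (1 - a)))"
      using sums_mult[OF geometric_sums[of a], of "q ^ k * w k"] a_pos a_less_1
        pmf_advance_weighted[of k]
      by (simp add: s True add.commute)
    then have down: "(\<lambda>h. w h * pmf (advance (1 - q) 1 h 0) s) sums (q ^ k * w k * (1 / (1 - a)))"
      by (subst (asm) sums_iff_shift) (simp add: s adv0)
    have sums: "(\<lambda>h. w h * pmf (K (h, 0)) s) sums w k"
    proof -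
      have "(\<lambda>h. w h * (a * of_bool (k = Suc h)) + (1 - a) * (w h * pmf (advance (1 - q) 1 h 0) s))
          sums (w k * (1 - q ^ k) + (1 - a) * (q ^ k * w k * (1 / (1 - a))))"
        by (intro sums_add up sums_mult down)
      moreover have "w k * (1 - q ^ k) + (1 - a) * (q ^ k * w k * (1 / (1 - a))) = w k"
        using a_less_1 by (simp add: right_diff_distrib)
      ultimately show ?thesis
        by (simp add: K s True algebra_simps)
    qed
    then have "pmf (bind_pmf (map_pmf (\<lambda>h. (h, 0)) dist_pmf) K) s = w k / F 1"
      unfolding bind by (subst expectation_dist_pmf(2)) (auto simp: sums_iff)
    also have "\<dots> = pmf (map_pmf (\<lambda>h. (h, 0)) dist_pmf) s"
      using pmf_map_inj'[of "\<lambda>h. (h, 0 :: nat)" dist_pmf k]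
      by (simp add: s True pmf_dist_pmf inj_on_def)
    finally show ?thesis .
  qed
qed

end

subsection \<open>The market\<close>

text \<open>An easy-to-match arrival is always served, as \<open>pE = 1\<close> and
  \<open>d \<ge> 1\<close>, and its segment may then empty the market.\<close>

lemma zero_in_set_pmf_arrival_step:
  assumes "0 < lH" "0 < lE" "0 < p" "p < 1" "d \<ge> 1"
  shows "(0, 0) \<in> set_pmf (arrival_step lH lE p 1 d s)"
proof -
  obtain h e where s: "s = (h, e)"
    by (cases s)
  have "set_pmf (bernoulli_pmf (lH / (lH + lE))) = UNIV"
    using assms by (intro set_pmf_bernoulli) auto
  moreover have "(0, 0) \<in> set_pmf (arrival p 1 d Easy s)"
    using assms zero_in_set_pmf_advance[of p h e] by (simp add: s)
  ultimately show ?thesis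
    unfolding arrival_step_def set_bind_pmf by (auto intro!: bexI[of _ False])
qed

text \<open>Only a hard-to-match arrival missed by all \<open>d\<close> bridge agents waits, hence
  the factor \<open>(1 - p) ^ d\<close>; an easy-to-match one waits with probability
  \<open>0 ^ d = 0\<close>.\<close>

lemma pmf_arrival_step_no_easy:
  assumes "0 < lH" "0 < lE" "0 < p" "p < 1" "d \<ge> 1"
  defines "a \<equiv> lH / (lH + lE) * (1 - p) ^ d"
  shows "pmf (arrival_step lH lE p 1 d (h, 0)) s
      = a * of_bool (s = (Suc h, 0)) + (1 - a) * pmf (advance p 1 h 0) s"
proof -
  define r where "r = lH / (lH + lE)"
  have a_r: "a = r * (1 - p) ^ d"
    by (simp add: a_def r_def)
  have r: "0 \<le> r" "r \<le> 1"
    using assms by (auto simp: r_def)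
  have "pmf (arrival_step lH lE p 1 d (h, 0)) s
      = r * pmf (arrival p 1 d Hard (h, 0)) s + (1 - r) * pmf (arrival p 1 d Easy (h, 0)) s"
    unfolding arrival_step_def r_def[symmetric] using r by (simp add: pmf_bind mult.commute)
  also have "\<dots> = r * ((1 - p) ^ d * of_bool (s = (Suc h, 0)) + (1 - (1 - p) ^ d) * pmf (advance p 1 h 0) s)
      + (1 - r) * pmf (advance p 1 h 0) s"
    using assms by (auto simp: pmf_bind_binomial_zero power_0_left)
  finally show ?thesis
    unfolding a_r by (simp add: algebra_simps)
qed

section \<open>Stationarity and uniqueness for the continuous-time chain\<close>

lemma bind_funpow_bind_pmf:
  fixes K :: "'a \<Rightarrow> 'a pmf"
  shows
  "bind_pmf D (\<lambda>s. ((\<lambda>D. bind_pmf D K) ^^ n) (return_pmf s)) = ((\<lambda>D. bind_pmf D K) ^^ n) D"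
proof (induction n)
  case 0
  then show ?case
    by (simp add: bind_return_pmf')
next
  case (Suc n)
  then show ?case
    by (simp add: bind_assoc_pmf[symmetric])
qed

text \<open>A law fixed by one arrival is fixed by any number of them, hence by a Poisson number
  independent of the state; \<open>bind_commute_pmf\<close> draws that number first.\<close>

lemma stationary_if_invariant:
  assumes "bind_pmf D (arrival_step lH lE pH pE d) = D"
  shows "stationary lH lE pH pE d D"
proof -
  have "((\<lambda>D. bind_pmf D (arrival_step lH lE pH pE d)) ^^ n) D = D" for n
    by (induction n) (simp_all add: assms)
  then show ?thesis
    unfolding stationary_def market_law_def
    by (subst bind_commute_pmf) (simp add: bind_funpow_bind_pmf)
qed

text \<open>The time span 1 is enough: exactly one arrival has positive probability, and from every
  state it can empty the market.\<close>

lemma stationary_pmf_unique: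
  assumes "0 < lH" "0 < lE" "0 < p" "p < 1" "d \<ge> 1"
    and "stationary lH lE p 1 d D" "stationary lH lE p 1 d E"
  shows "D = E"
proof (rule stationary_unique)
  show "bind_pmf D (market_law lH lE p 1 d 1) = D" "bind_pmf E (market_law lH lE p 1 d 1) = E"
    using assms by (auto simp: stationary_def)
  fix s
  have "(0, 0) \<in> set_pmf (((\<lambda>D. bind_pmf D (arrival_step lH lE p 1 d)) ^^ 1) (return_pmf s))"
    using zero_in_set_pmf_arrival_step[OF assms(1-5)] by simp
  then show "(0, 0) \<in> set_pmf (market_law lH lE p 1 d 1 s)"
    using assms unfolding market_law_def set_bind_pmf by (subst set_pmf_poisson) (auto intro!: exI[of _ 1])
qed

lemma steady_state_bounds:
  fixes lH lE p :: real and d :: nat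
  assumes "0 < lH" "0 < lE" "0 < p" "p < 1" "d \<ge> 1"
  defines "\<rho> \<equiv> lH / (lH + lE)"
  shows "\<exists>!D. stationary lH lE p 1 d D"
    and "integrable (measure_pmf (steady_state lH lE p 1 d)) (\<lambda>(h, e). real h)"
    and "- ln (1 - \<rho> * (1 - p) ^ d) / lH \<le> p * wH lH lE p 1 d"
    and "p * wH lH lE p 1 d \<le> - (1 - p) * ln (1 - \<rho> * (1 - p) ^ (d - 1)) / lH"
proof -
  define a where "a = \<rho> * (1 - p) ^ d"
  have \<rho>: "0 < \<rho>" "\<rho> < 1"
    using assms by (auto simp: \<rho>_def)
  have pow: "0 < (1 - p) ^ n" "(1 - p) ^ n \<le> 1" for n
    using assms by (auto simp: power_le_one)
  \<comment> \<open>So \<open>a / q\<close> is \<open>\<rho> * (1 - p) ^ (d - 1)\<close>, the source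
    of the exponent \<open>d - 1\<close> in the upper bound.\<close>
  have a_eq: "a = \<rho> * (1 - p) ^ (d - 1) * (1 - p)"
    using \<open>d \<ge> 1\<close> by (cases d) (simp_all add: a_def)
  have le_\<rho>: "\<rho> * (1 - p) ^ n \<le> \<rho>" for n
    using \<rho> pow[of n] by (simp add: mult_left_le)
  have a: "0 < a" "a < 1"
    using mult_pos_pos[OF \<rho>(1) pow(1)[of d]] \<rho>(2) le_\<rho>[of d] unfolding a_def by linarith+
  interpret q_series a "1 - p"
    using assms a by unfold_locales auto
  define D where "D = map_pmf (\<lambda>h. (h, 0 :: nat)) dist_pmf"
  have "bind_pmf D (arrival_step lH lE p 1 d) = D"
    unfolding D_def using assms
    by (intro dist_pmf_invariant) (simp add: pmf_arrival_step_no_easy a_def \<rho>_def)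
  then have D: "stationary lH lE p 1 d D"
    by (rule stationary_if_invariant)
  then show ex1: "\<exists>!D. stationary lH lE p 1 d D"
    using stationary_pmf_unique[OF assms(1-5)] by blast
  have steady: "steady_state lH lE p 1 d = D"
    unfolding steady_state_def using D ex1 by (rule the1_equality[rotated])
  show "integrable (measure_pmf (steady_state lH lE p 1 d)) (\<lambda>(h, e). real h)"
    using mean_dist_pmf(1) by (simp add: steady D_def)
  have wH: "wH lH lE p 1 d = L 1 / lH"
    using mean_dist_pmf(2) by (simp add: wH_def steady D_def)
  show "- ln (1 - \<rho> * (1 - p) ^ d) / lH \<le> p * wH lH lE p 1 d"
    using divide_right_mono[OF L_1_lower, of lH] \<open>0 < lH\<close> by (simp add: wH a_def)
  have "\<rho> * (1 - p) ^ (d - 1) < 1"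
    using le_\<rho>[of "d - 1"] \<rho>(2) by linarith
  then have "a < 1 - p"
    using \<open>p < 1\<close> by (simp add: a_eq)
  then have "p * L 1 \<le> - (1 - p) * ln (1 - \<rho> * (1 - p) ^ (d - 1))"
    using L_1_upper \<open>p < 1\<close> by (simp add: a_eq)
  then show "p * wH lH lE p 1 d \<le> - (1 - p) * ln (1 - \<rho> * (1 - p) ^ (d - 1)) / lH"
    using \<open>0 < lH\<close> unfolding wH times_divide_eq_right by (intro divide_right_mono) auto
qed

section \<open>The limit and its monotonicity in both rates\<close>

lemma wH_limit:
  fixes lH lE :: real and d :: nat
  assumes "0 < lH" "0 < lE" "d \<ge> 1"
  shows "((\<lambda>p. p * wH lH lE p 1 d) \<longlongrightarrow> ln (lH / lE + 1) / lH) (at_right 0)"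
proof -
  define \<rho> where "\<rho> = lH / (lH + lE)"
  have \<rho>: "\<rho> < 1"
    using assms by (simp add: \<rho>_def)
  have "1 - \<rho> = inverse (lH / lE + 1)"
    using assms by (simp add: \<rho>_def field_simps)
  \<comment> \<open>Arbitrary \<open>n\<close>, because the two sandwiching bounds have exponents
    \<open>d\<close> and \<open>d - 1\<close> but the same limit.\<close>
  then have lim: "ln (lH / lE + 1) / lH = - ln (1 - \<rho> * (1 - 0) ^ n) / lH" for n
    using assms by (simp add: ln_inverse)
  have ev: "\<forall>\<^sub>F p in at_right (0 :: real). 0 < p \<and> p < 1"
    using eventually_at_right_less[of "0 :: real"] eventually_at_right[of 0 "1 :: real"]
    by (auto simp: eventually_at_right_field intro!: exI[of _ 1])
  show ?thesis
  proof (rule tendsto_sandwich)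
    show "\<forall>\<^sub>F p in at_right 0. - ln (1 - \<rho> * (1 - p) ^ d) / lH \<le> p * wH lH lE p 1 d"
      using ev by eventually_elim (use assms steady_state_bounds(3) in \<open>auto simp: \<rho>_def\<close>)
    show "\<forall>\<^sub>F p in at_right 0.
        p * wH lH lE p 1 d \<le> - (1 - p) * ln (1 - \<rho> * (1 - p) ^ (d - 1)) / lH"
      using ev by eventually_elim (use assms steady_state_bounds(4) in \<open>auto simp: \<rho>_def\<close>)
    show "((\<lambda>p. - ln (1 - \<rho> * (1 - p) ^ d) / lH) \<longlongrightarrow> ln (lH / lE + 1) / lH) (at_right 0)"
      unfolding lim[of d] using \<rho> assms by (intro tendsto_intros) auto
    have "((\<lambda>p. - (1 - p) * ln (1 - \<rho> * (1 - p) ^ (d - 1)) / lH)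
        \<longlongrightarrow> - (1 - 0) * ln (1 - \<rho> * (1 - 0) ^ (d - 1)) / lH) (at_right 0)"
      using \<rho> assms by (intro tendsto_intros) auto
    then show "((\<lambda>p. - (1 - p) * ln (1 - \<rho> * (1 - p) ^ (d - 1)) / lH)
        \<longlongrightarrow> ln (lH / lE + 1) / lH) (at_right 0)"
      using lim[of "d - 1"] by simp
  qed
qed

text \<open>The quotient is the slope of the chord from the origin to the graph of the strictly
  concave function \<open>ln (x + 1)\<close>. The tangent at \<open>x\<close> bounds
  \<open>ln (y + 1)\<close>, and its slope \<open>1 / (x + 1)\<close> is below that of the
  chord.\<close>

lemma ln_add_one_over_strict_antimono:
  fixes x y :: real
  assumes "0 < x" "x < y"
  shows "ln (y + 1) / y < ln (x + 1) / x"
proof -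
  have 1: "ln ((y + 1) / (x + 1)) \<le> (y + 1) / (x + 1) - 1"
    using assms by (intro ln_le_minus_one) auto
  \<comment> \<open>Strictness enters here: \<open>ln t = t - 1\<close> holds only at
    \<open>t = 1\<close>.\<close>
  have "ln (1 / (x + 1)) < 1 / (x + 1) - 1"
    using assms ln_eq_minus_one[of "1 / (x + 1)"] ln_le_minus_one[of "1 / (x + 1)"]
    by (force simp: less_le)
  then have 2: "x / (x + 1) < ln (x + 1)"
    using assms by (simp add: ln_div field_simps)
  have "x * ln (y + 1) = x * ln (x + 1) + x * ln ((y + 1) / (x + 1))"
    using assms by (simp add: ln_div algebra_simps)
  also have "\<dots> \<le> x * ln (x + 1) + x * ((y + 1) / (x + 1) - 1)"
    using 1 assms by simp
  also have "x * ((y + 1) / (x + 1) - 1) = (y - x) * (x / (x + 1))"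
    using assms by (simp add: field_simps)
  also have "\<dots> < (y - x) * ln (x + 1)"
    using 2 assms by (intro mult_strict_left_mono) auto
  finally have "x * ln (y + 1) < y * ln (x + 1)"
    by (simp add: algebra_simps)
  then show ?thesis
    using assms by (simp add: field_simps)
qed

theorem proposition1:
  fixes lH lE :: real and d :: nat
  assumes "lH > 0" and "lE > 0" and "d \<ge> 1"
  shows "(\<forall>pH\<in>{0<..<1}. (\<exists>!D. stationary lH lE pH 1 d D) \<and>
            integrable (measure_pmf (steady_state lH lE pH 1 d)) (\<lambda>(h, e). real h)) \<and>
         ((\<lambda>pH. pH * wH lH lE pH 1 d) \<longlongrightarrow> ln (lH / lE + 1) / lH) (at_right 0) \<and>
         strict_antimono_on {0<..} (\<lambda>lE'. Lim (at_right 0) (\<lambda>pH. pH * wH lH lE' pH 1 d)) \<and>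
         strict_antimono_on {0<..} (\<lambda>lH'. Lim (at_right 0) (\<lambda>pH. pH * wH lH' lE pH 1 d))"
proof (intro conjI ballI)
  have Lim: "Lim (at_right 0) (\<lambda>pH. pH * wH x y pH 1 d) = ln (x / y + 1) / x"
    if "0 < x" "0 < y" for x y
    using wH_limit[OF that \<open>d \<ge> 1\<close>] by (intro tendsto_Lim) simp_all
  show "strict_antimono_on {0<..} (\<lambda>lE'. Lim (at_right 0) (\<lambda>pH. pH * wH lH lE' pH 1 d))"
    using \<open>lH > 0\<close>
    by (intro monotone_onI) (auto simp: Lim add_pos_pos intro!: divide_strict_right_mono divide_strict_left_mono)
  show "strict_antimono_on {0<..} (\<lambda>lH'. Lim (at_right 0) (\<lambda>pH. pH * wH lH' lE pH 1 d))"
  proof (rule monotone_onI)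
    fix x y :: real
    assume xy: "x \<in> {0<..}" "y \<in> {0<..}" "x < y"
    \<comment> \<open>Up to the constant factor \<open>1 / lE\<close>, the limit is the chord slope
      at the ratio of the two rates.\<close>
    have "ln (y / lE + 1) / (y / lE) < ln (x / lE + 1) / (x / lE)"
      using xy \<open>lE > 0\<close> by (intro ln_add_one_over_strict_antimono) (auto simp: divide_strict_right_mono)
    then show "Lim (at_right 0) (\<lambda>pH. pH * wH y lE pH 1 d) < Lim (at_right 0) (\<lambda>pH. pH * wH x lE pH 1 d)"
      using xy \<open>lE > 0\<close> by (simp add: Lim field_simps)
  qed
qed (use assms steady_state_bounds(1,2) wH_limit in auto)

end
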